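(* Let $(X,S)$ be an indecomposable nondegenerate symmetric set with $|X|=p$, where $p$ is a prime. Then $(X,S)$ is isomorphic to the cyclic permutation solution $(\mathbb{Z}/p\mathbb{Z},S_0)$, where $S_0(x,y)=(y-1,x+1)$.
   Context: Let $X$ be a nonempty set and $S:X\times X\to X\times X$ a bijection, $S(x,y)=(g_x(y),f_y(x))$. $(X,S)$ is nondegenerate if all maps $f_y,g_x:X\to X$ are bijections; braided if $S^{12}S^{23}S^{12}=S^{23}S^{12}S^{23}$ on $X^3$ (with $S^{12}=S\times\mathrm{id}$, $S^{23}=\mathrm{id}\times S$); involutive if $S^2=\mathrm{id}$; symmetric if braided and involutive. $(X,S)$ and $(X',S')$ are isomorphic if there is a bijection $X\to X'$ carrying $S$ to $S'$. A subset $Y\subset X$ is invariant if $S(Y\times Y)\subset Y\times Y$; an invariant subset $Y$ is nondegenerate if $(Y,S|_{Y\times Y})$ is a nondegenerate symmetric set. A nondegenerate symmetric set $(X,S)$ is decomposable if it is a union of two nonempty disjoint nondegenerate invariant subsets, and indecomposable otherwise. *)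

theory Defs
  imports "HOL-Number_Theory.Number_Theory"
begin

text \<open>
  Set-theoretic solutions are pairs \<open>(X, S)\<close> of a carrier set and a map on pairs. Every predicate
  below depends only on the values of \<open>S\<close> on \<open>X \<times> X\<close>, so that for an invariant subset \<open>Y\<close> the pair
  \<open>(Y, S)\<close> stands for \<open>Y\<close> with the restriction of \<open>S\<close> to \<open>Y \<times> Y\<close>.
\<close>

definition g_map :: "('a \<times> 'a \<Rightarrow> 'a \<times> 'a) \<Rightarrow> 'a \<Rightarrow> 'a \<Rightarrow> 'a" where
  "g_map S x y = fst (S (x, y))"

definition f_map :: "('a \<times> 'a \<Rightarrow> 'a \<times> 'a) \<Rightarrow> 'a \<Rightarrow> 'a \<Rightarrow> 'a" where
  "f_map S y x = snd (S (x, y))"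

definition bijective_pair :: "'a set \<Rightarrow> ('a \<times> 'a \<Rightarrow> 'a \<times> 'a) \<Rightarrow> bool" where
  "bijective_pair X S \<longleftrightarrow> X \<noteq> {} \<and> bij_betw S (X \<times> X) (X \<times> X)"

definition nondegenerate :: "'a set \<Rightarrow> ('a \<times> 'a \<Rightarrow> 'a \<times> 'a) \<Rightarrow> bool" where
  "nondegenerate X S \<longleftrightarrow>
     (\<forall>y\<in>X. bij_betw (f_map S y) X X) \<and> (\<forall>x\<in>X. bij_betw (g_map S x) X X)"

definition S12 :: "('a \<times> 'a \<Rightarrow> 'a \<times> 'a) \<Rightarrow> 'a \<times> 'a \<times> 'a \<Rightarrow> 'a \<times> 'a \<times> 'a" where
  "S12 S = (\<lambda>(x, y, z). case S (x, y) of (u, v) \<Rightarrow> (u, v, z))"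

definition S23 :: "('a \<times> 'a \<Rightarrow> 'a \<times> 'a) \<Rightarrow> 'a \<times> 'a \<times> 'a \<Rightarrow> 'a \<times> 'a \<times> 'a" where
  "S23 S = map_prod id S"

definition braided :: "'a set \<Rightarrow> ('a \<times> 'a \<Rightarrow> 'a \<times> 'a) \<Rightarrow> bool" where
  "braided X S \<longleftrightarrow>
     (\<forall>t \<in> X \<times> X \<times> X. (S12 S \<circ> S23 S \<circ> S12 S) t = (S23 S \<circ> S12 S \<circ> S23 S) t)"

definition involutive :: "'a set \<Rightarrow> ('a \<times> 'a \<Rightarrow> 'a \<times> 'a) \<Rightarrow> bool" where
  "involutive X S \<longleftrightarrow> (\<forall>t \<in> X \<times> X. S (S t) = t)"

definition nondegenerate_symmetric_set :: "'a set \<Rightarrow> ('a \<times> 'a \<Rightarrow> 'a \<times> 'a) \<Rightarrow> bool" where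
  "nondegenerate_symmetric_set X S \<longleftrightarrow>
     bijective_pair X S \<and> nondegenerate X S \<and> braided X S \<and> involutive X S"

definition isomorphic_pairs ::
    "'a set \<Rightarrow> ('a \<times> 'a \<Rightarrow> 'a \<times> 'a) \<Rightarrow> 'b set \<Rightarrow> ('b \<times> 'b \<Rightarrow> 'b \<times> 'b) \<Rightarrow> bool" where
  "isomorphic_pairs X S X' S' \<longleftrightarrow>
     (\<exists>\<phi>. bij_betw \<phi> X X' \<and>
          (\<forall>t \<in> X \<times> X. map_prod \<phi> \<phi> (S t) = S' (map_prod \<phi> \<phi> t)))"

definition invariant_subset :: "'a set \<Rightarrow> ('a \<times> 'a \<Rightarrow> 'a \<times> 'a) \<Rightarrow> 'a set \<Rightarrow> bool" where
  "invariant_subset X S Y \<longleftrightarrow> Y \<subseteq> X \<and> S ` (Y \<times> Y) \<subseteq> Y \<times> Y"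

definition nondegenerate_invariant_subset ::
    "'a set \<Rightarrow> ('a \<times> 'a \<Rightarrow> 'a \<times> 'a) \<Rightarrow> 'a set \<Rightarrow> bool" where
  "nondegenerate_invariant_subset X S Y \<longleftrightarrow>
     invariant_subset X S Y \<and> nondegenerate_symmetric_set Y S"

definition decomposable :: "'a set \<Rightarrow> ('a \<times> 'a \<Rightarrow> 'a \<times> 'a) \<Rightarrow> bool" where
  "decomposable X S \<longleftrightarrow>
     (\<exists>Y Z. Y \<noteq> {} \<and> Z \<noteq> {} \<and> Y \<inter> Z = {} \<and> Y \<union> Z = X \<and>
            nondegenerate_invariant_subset X S Y \<and> nondegenerate_invariant_subset X S Z)"

definition cyclic_S0 :: "nat \<Rightarrow> int \<times> int \<Rightarrow> int \<times> int" where
  "cyclic_S0 n = (\<lambda>(x, y).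
     (y \<ominus>\<^bsub>residue_ring (int n)\<^esub> \<one>\<^bsub>residue_ring (int n)\<^esub>,
      x \<oplus>\<^bsub>residue_ring (int n)\<^esub> \<one>\<^bsub>residue_ring (int n)\<^esub>))"

end

theory Submission
  imports Defs "HOL-Algebra.Sylow" "HOL-Combinatorics.Orbits" "HOL-Combinatorics.Cycles"
begin

text \<open>
  Let \<open>\<sigma> y\<close> be the inverse of \<open>f_map S y\<close>. Involutivity expresses \<open>g_map\<close> through \<open>\<sigma>\<close>, and the braid
  relation becomes the cycle identity \<open>\<sigma> (\<sigma> x y) \<circ> \<sigma> x = \<sigma> (\<sigma> y x) \<circ> \<sigma> y\<close>. This identity allows one to attach
  to every finite multiset \<open>a\<close> of points a permutation \<open>act a\<close>, such that \<open>act {#x#} = \<sigma> x\<close> and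
  \<open>act (a + b) = act (act a b) \<circ> act a\<close>, where \<open>act a b\<close> is short for the image of the multiset \<open>b\<close>. The
  permutations \<open>act a\<close> form a group \<open>G\<close> under composition. They also form a commutative group under the
  addition inherited from multisets, and \<open>G\<close> acts on this additive group by automorphisms.

  Indecomposability means that \<open>G\<close> is transitive (\<open>indecomposable_imp_transitive\<close>). Hence the order of
  \<open>G\<close> is a multiple of \<open>p\<close>; it also divides \<open>p!\<close>, so it equals \<open>p * m\<close> with \<open>m\<close> prime to \<open>p\<close>. The \<open>p\<close>-torsion
  \<open>P\<close> of the additive group has \<open>p\<close> elements, is closed under composition as well, and is therefore
  transitive on the \<open>p\<close> points (\<open>P_transitive\<close>). It acts on its own \<open>p\<close> elements and fixes the neutral
  one, so it acts on them trivially (\<open>P_acts_trivially\<close>). Consequently \<open>m\<close> copies of a point represent the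
  same element of \<open>P\<close> for all points, and this element has order \<open>p\<close>. Thus the number of elements of \<open>a\<close>,
  taken modulo \<open>p\<close>, depends only on \<open>act a\<close>; it is a homomorphism on \<open>G\<close> whose kernel \<open>N\<close> is the
  \<open>m\<close>-torsion (\<open>act_in_torsion_iff\<close>, \<open>N_normal\<close>).

  A nontrivial normal subgroup of a transitive group of prime degree \<open>p\<close> is transitive, so its order is
  a multiple of \<open>p\<close>. The order of \<open>N\<close> is prime to \<open>p\<close>, hence \<open>N\<close> is trivial (\<open>N_trivial\<close>). As all \<open>\<sigma> x\<close>
  have degree one, they coincide (\<open>sigma_constant\<close>), and a single permutation that generates a
  transitive group on \<open>p\<close> points is a cycle of length \<open>p\<close>.
\<close>

section \<open>Torsion in finite commutative groups\<close>

text \<open>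
  A Sylow subgroup for the first power of \<open>q\<close> has exactly \<open>q\<close> elements, so any non-identity element of it will do.
\<close>

lemma (in group) cauchy:
  assumes fin: "finite (carrier G)" and q: "prime q" and dvd: "q dvd order G"
  obtains u where "u \<in> carrier G" "u \<noteq> \<one>" "u [^] q = \<one>"
proof -
  obtain m where "order G = q ^ 1 * m" using dvd by auto
  with q fin obtain H where H: "subgroup H G" "card H = q"
    using sylow_thm[OF q group_axioms] by (metis power_one_right)
  have "\<not> H \<subseteq> {\<one>}"
  proof
    assume "H \<subseteq> {\<one>}"
    then have "card H \<le> 1" using card_mono[of "{\<one>}" H] by simp
    then show False using H q prime_gt_1_nat[of q] by simp
  qed
  then obtain u where u: "u \<in> H" "u \<noteq> \<one>" by auto
  interpret H: group "G\<lparr>carrier := H\<rparr>" using H subgroup_imp_group by blast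
  have "u [^]\<^bsub>G\<lparr>carrier := H\<rparr>\<^esub> order (G\<lparr>carrier := H\<rparr>) = \<one>\<^bsub>G\<lparr>carrier := H\<rparr>\<^esub>"
    using u by (intro H.pow_order_eq_1) simp
  then have "u [^] q = \<one>" using H(2) by (simp add: order_def nat_pow_consistent[symmetric])
  then show ?thesis using that u H(1) subgroup.subset by blast
qed

lemma (in group) pow_eq_one_imp_dvd:
  assumes "prime p" "u \<in> carrier G" "u \<noteq> \<one>" "u [^] p = \<one>" "u [^] (k::nat) = \<one>"
  shows "p dvd k"
proof -
  have "ord u = p"
    using assms pow_eq_id[of u p] prime_nat_iff[of p] ord_eq_1[of u] by auto
  then show ?thesis using assms pow_eq_id by blast
qed

definition torsion :: "('a, 'b) monoid_scheme \<Rightarrow> nat \<Rightarrow> 'a set" where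
  "torsion G n = {u \<in> carrier G. u [^]\<^bsub>G\<^esub> n = \<one>\<^bsub>G\<^esub>}"

lemma (in comm_group) subgroup_torsion: "subgroup (torsion G n) G"
  by (unfold_locales) (auto simp: torsion_def nat_pow_distrib nat_pow_inv)

lemma (in comm_group) prime_dvd_card_torsion:
  assumes fin: "finite (carrier G)" and q: "prime q" and n: "q dvd card (torsion G n)"
  shows "q dvd n"
proof -
  let ?T = "torsion G n"
  have T: "?T \<subseteq> carrier G" by (auto simp: torsion_def)
  interpret T: group "G\<lparr>carrier := ?T\<rparr>" using subgroup_torsion subgroup_imp_group by blast
  obtain u where u: "u \<in> ?T" "u \<noteq> \<one>" "u [^] q = \<one>"
    using T.cauchy[OF _ q] n finite_subset[OF T fin]
    by (auto simp: order_def nat_pow_consistent[symmetric])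
  then show ?thesis using pow_eq_one_imp_dvd[OF q] by (auto simp: torsion_def)
qed

text \<open>
  By Cauchy's theorem the order of the \<open>p\<close>-torsion has no prime divisor other than \<open>p\<close>. It divides the
  order of the group, in which \<open>p\<close> occurs only to the first power.
\<close>

lemma (in comm_group) card_torsion_prime:
  assumes fin: "finite (carrier G)" and p: "prime p"
    and dvd: "p dvd order G" and sq: "\<not> p\<^sup>2 dvd order G"
  shows "card (torsion G p) = p"
proof -
  have sub: "torsion G p \<subseteq> carrier G" by (auto simp: torsion_def)
  have dvd': "card (torsion G p) dvd order G"
    using lagrange[OF subgroup_torsion] by (metis dvd_triv_right)
  obtain u where "u \<in> carrier G" "u \<noteq> \<one>" "u [^] p = \<one>" using cauchy[OF fin p dvd] .
  then have "{\<one>, u} \<subseteq> torsion G p" "card {\<one>, u} = 2" by (auto simp: torsion_def)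
  then have "card (torsion G p) \<noteq> 1"
    using card_mono[of "torsion G p" "{\<one>, u}"] finite_subset[OF sub fin] by auto
  then obtain q where q: "prime q" "q dvd card (torsion G p)" using prime_factor_nat by blast
  then have "q = p" using prime_dvd_card_torsion[OF fin] p primes_dvd_imp_eq by blast
  then obtain k where k: "card (torsion G p) = p * k" using q by auto
  have "k = 1"
  proof (rule ccontr)
    assume "k \<noteq> 1"
    then obtain r where r: "prime r" "r dvd k" using prime_factor_nat by blast
    then have "r = p" using prime_dvd_card_torsion[OF fin, of r p] p primes_dvd_imp_eq k by auto
    then have "p\<^sup>2 dvd card (torsion G p)" using r k by (simp add: power2_eq_square)
    then show False using dvd' sq dvd_trans by blast
  qed
  then show ?thesis using k by simp
qed

section \<open>Finite groups of permutations\<close>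

text \<open>
  For permutations of a finite set, closure under composition implies closure under inverses (lemma
  \<open>perm_group_inv\<close>).
\<close>

definition perm_group :: "'a set \<Rightarrow> ('a \<Rightarrow> 'a) set \<Rightarrow> bool" where
  "perm_group X H \<longleftrightarrow> (\<forall>h\<in>H. h permutes X) \<and> id \<in> H \<and> (\<forall>g\<in>H. \<forall>h\<in>H. g \<circ> h \<in> H)"

lemma perm_group_permutes: "perm_group X H \<Longrightarrow> h \<in> H \<Longrightarrow> h permutes X"
  and perm_group_id: "perm_group X H \<Longrightarrow> id \<in> H"
  and perm_group_comp: "perm_group X H \<Longrightarrow> g \<in> H \<Longrightarrow> h \<in> H \<Longrightarrow> g \<circ> h \<in> H"
  by (auto simp: perm_group_def)

lemma perm_group_finite: "finite X \<Longrightarrow> perm_group X H \<Longrightarrow> finite H"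
  by (rule finite_subset[OF _ finite_permutations]) (auto dest: perm_group_permutes)

lemma perm_group_inv:
  assumes X: "finite X" and H: "perm_group X H" and h: "h \<in> H"
  shows "Hilbert_Choice.inv h \<in> H"
proof -
  have hX: "h permutes X" using perm_group_permutes H h .
  then have "permutation h" using X permutation_permutes by blast
  then obtain n where n: "h ^^ n = id" "n > 0" by (rule permutation_is_nilpotent)
  have pow: "h ^^ k \<in> H" for k
    using perm_group_id[OF H] perm_group_comp[OF H h] by (induction k) (simp_all only: funpow.simps)
  have "h \<circ> h ^^ (n - 1) = id" using n by (metis Suc_diff_1 funpow.simps(2))
  then have "Hilbert_Choice.inv h = h ^^ (n - 1)"
    using permutes_inv_o(2)[OF hX] by (metis comp_assoc comp_id id_comp)
  then show ?thesis using pow by simp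
qed

text \<open>
  An orbit-stabilizer theorem without an explicit action: if the value of \<open>F\<close> at a product depends on
  the right factor only through its \<open>F\<close>-value, then left multiplication by \<open>h\<close> carries the fibre
  over \<open>F id\<close> bijectively onto the fibre over \<open>F h\<close>, so all fibres are equally large. Taking for \<open>F h\<close> the
  image under \<open>h\<close> of a point, a coset, a class of multisets or an orbit of another group gives all the
  divisibility statements used below.
\<close>

lemma card_image_mult_card_fibre:
  assumes X: "finite X" and H: "perm_group X H"
    and F: "\<And>g h k. g \<in> H \<Longrightarrow> h \<in> H \<Longrightarrow> k \<in> H \<Longrightarrow> F h = F k \<Longrightarrow> F (g \<circ> h) = F (g \<circ> k)"
  shows "card (F ` H) * card {k \<in> H. F k = F id} = card H"
proof -
  have fin: "finite H" using perm_group_finite X H .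
  have fibre: "card {k \<in> H. F k = y} = card {k \<in> H. F k = F id}" if "y \<in> F ` H" for y
  proof -
    obtain h where h: "h \<in> H" "y = F h" using \<open>y \<in> F ` H\<close> by auto
    have hX: "h permutes X" using perm_group_permutes H h(1) .
    note ih = perm_group_inv[OF X H h(1)]
    have "{k \<in> H. F k = y} = (\<circ>) h ` {k \<in> H. F k = F id}"
    proof (intro equalityI subsetI)
      fix k assume k: "k \<in> {k \<in> H. F k = y}"
      then have kH: "k \<in> H" and Fk: "F k = F h" using h(2) by auto
      have "F (Hilbert_Choice.inv h \<circ> k) = F id"
        using F[OF ih kH h(1) Fk] permutes_inv_o(2)[OF hX] by metis
      moreover have "k = h \<circ> (Hilbert_Choice.inv h \<circ> k)"
        using permutes_inv_o(1)[OF hX] by (metis comp_assoc id_comp)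
      ultimately show "k \<in> (\<circ>) h ` {k \<in> H. F k = F id}"
        using perm_group_comp[OF H ih kH] by blast
    next
      fix k assume "k \<in> (\<circ>) h ` {k \<in> H. F k = F id}"
      then obtain l where l: "l \<in> H" "F l = F id" and k: "k = h \<circ> l" by auto
      have "F k = F h" using F[OF h(1) l(1) perm_group_id[OF H] l(2)] k by (metis comp_id)
      then show "k \<in> {k \<in> H. F k = y}" using perm_group_comp[OF H h(1) l(1)] h(2) k by blast
    qed
    moreover have "inj_on ((\<circ>) h) A" for A :: "('a \<Rightarrow> 'a) set"
      using permutes_inj[OF hX] by (auto simp: inj_on_def fun_eq_iff)
    ultimately show ?thesis by (simp only: card_image)
  qed
  have "card H = (\<Sum>y\<in>F ` H. \<Sum>k | k \<in> H \<and> F k = y. 1)"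
    using sum.image_gen[OF fin, of "\<lambda>_. 1::nat" F] by simp
  also have "\<dots> = (\<Sum>y\<in>F ` H. card {k \<in> H. F k = F id})"
    using fibre by (intro sum.cong) auto
  finally show ?thesis by simp
qed

lemma card_orbit_dvd:
  assumes "finite X" "perm_group X H"
  shows "card ((\<lambda>h. h x) ` H) dvd card H"
  using card_image_mult_card_fibre[OF assms, of "\<lambda>h. h x"] by (metis (no_types, lifting) comp_apply dvd_triv_left)

text \<open>
  Lagrange's theorem for \<open>H\<close> in the full symmetric group, where \<open>F g\<close> is the left coset of \<open>g\<close>.
\<close>

lemma card_perm_group_dvd_fact:
  assumes X: "finite X" and H: "perm_group X H"
  shows "card H dvd fact (card X)"
proof -
  let ?S = "{h. h permutes X}" and ?F = "\<lambda>g. (\<circ>) g ` H"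
  have S: "perm_group X ?S" by (auto simp: perm_group_def permutes_id permutes_compose)
  have comp: "?F (g \<circ> h) = (\<circ>) g ` ?F h" for g h by (auto simp: image_image comp_assoc)
  have "card (?F ` ?S) * card {k \<in> ?S. ?F k = ?F id} = card ?S"
    by (intro card_image_mult_card_fibre[OF X S]) (simp add: comp)
  moreover have "{k \<in> ?S. ?F k = ?F id} = H"
  proof (intro equalityI subsetI)
    fix k assume "k \<in> {k \<in> ?S. ?F k = ?F id}"
    then have "k \<circ> id \<in> ?F id" using perm_group_id[OF H] by blast
    then show "k \<in> H" by auto
  next
    fix k assume k: "k \<in> H"
    have kX: "k permutes X" using perm_group_permutes H k .
    have "h \<in> ?F k" if "h \<in> H" for h
    proof
      show "h = k \<circ> (Hilbert_Choice.inv k \<circ> h)"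
        using permutes_inv_o(1)[OF kX] by (simp add: comp_assoc[symmetric])
      show "Hilbert_Choice.inv k \<circ> h \<in> H"
        using perm_group_comp[OF H perm_group_inv[OF X H k] that] .
    qed
    then have "H \<subseteq> ?F k" by blast
    then show "k \<in> {k \<in> ?S. ?F k = ?F id}" using kX perm_group_comp[OF H k] by auto
  qed
  ultimately show ?thesis using card_permutations[OF refl X] by (metis dvd_triv_right)
qed

lemma not_prime_square_dvd_fact:
  fixes p :: nat
  assumes "prime p"
  shows "\<not> p\<^sup>2 dvd fact p"
proof
  assume *: "p\<^sup>2 dvd fact p"
  have "p > 0" using assms prime_gt_0_nat by blast
  then have "fact p = p * (fact (p - 1) :: nat)" by (metis fact_reduce of_nat_id)
  with * \<open>p > 0\<close> have "p dvd fact (p - 1)" by (simp add: power2_eq_square)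
  then show False using prime_dvd_fact_iff[OF assms] \<open>p > 0\<close> by simp
qed

section \<open>Cycle sets and their additive permutation group\<close>

text \<open>
  The set \<open>X\<close> with the binary operation \<open>\<sigma>\<close> is a cycle set in the sense of Rump, up to notation. The
  operation is extended to the whole type by identity maps; the cycle identity survives this
  extension, and no carrier conditions have to be tracked for multisets of letters.
\<close>

locale finite_cycle_set =
  fixes X :: "'a set" and \<sigma> :: "'a \<Rightarrow> 'a \<Rightarrow> 'a"
  assumes finite_X: "finite X"
    and permutes: "\<And>x. \<sigma> x permutes X"
    and outside: "\<And>x. x \<notin> X \<Longrightarrow> \<sigma> x = id"
    and cycle: "\<And>x y. \<sigma> (\<sigma> x y) \<circ> \<sigma> x = \<sigma> (\<sigma> y x) \<circ> \<sigma> y"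
begin

text \<open>
  Letters are processed one at a time: a letter \<open>x\<close> arriving when the permutation \<open>\<pi>\<close> has been reached
  contributes the permutation attached to \<open>\<pi> x\<close>. The cycle identity says precisely that two
  consecutive letters may be exchanged, so that the result is a function of the multiset.
\<close>

definition act :: "'a multiset \<Rightarrow> 'a \<Rightarrow> 'a" where
  "act a = fold_mset (\<lambda>x \<pi>. \<sigma> (\<pi> x) \<circ> \<pi>) id a"

lemma act_empty [simp]: "act {#} = id"
  by (simp add: act_def)

lemma act_add_mset: "act (add_mset x a) = \<sigma> (act a x) \<circ> act a"
proof -
  interpret comp_fun_commute "\<lambda>x \<pi>. \<sigma> (\<pi> x) \<circ> \<pi>"
    by unfold_locales (use cycle in \<open>simp add: fun_eq_iff\<close>)
  show ?thesis by (simp add: act_def)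
qed

lemma act_single: "act {#x#} = \<sigma> x"
  by (simp add: act_add_mset)

lemma act_permutes: "act a permutes X"
proof (induction a)
  case (add x a)
  then show ?case unfolding act_add_mset using permutes by (rule permutes_compose)
qed (simp only: act_empty permutes_id)

text \<open>
  The cocycle identity. Since its left-hand side is symmetric in \<open>a\<close> and \<open>b\<close>, it links the
  composition of permutations with the addition of multisets.
\<close>

lemma act_union: "act (a + b) = act (image_mset (act a) b) \<circ> act a"
  by (induction b) (simp_all add: act_add_mset comp_assoc)

text \<open>
  The cocycle identity read backwards: the permutations \<open>act a\<close> are closed under composition.
\<close>

lemma comp_act: "act c \<circ> act a = act (a + image_mset (Hilbert_Choice.inv (act a)) c)"
  using permutes_inv_o(1)[OF act_permutes, of a]
  by (simp add: act_union multiset.map_comp)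

lemma perm_group_act: "perm_group X (range act)"
  unfolding perm_group_def
proof (intro conjI ballI)
  show "id \<in> range act" using act_empty by (metis rangeI)
qed (auto simp: act_permutes comp_act simp del: comp_apply)

lemma act_inverse: obtains d where "Hilbert_Choice.inv (act c) = act d"
  using perm_group_inv[OF finite_X perm_group_act, of "act c"] by auto

lemma act_cong_union_right:
  assumes "act a = act b" shows "act (a + c) = act (b + c)"
  using assms by (simp add: act_union)

text \<open>
  Equality of the permutations is a congruence for multiset addition: on the left summand by the
  cocycle identity, on the right one by commutativity.
\<close>

lemma act_cong_union:
  assumes "act a = act a'" "act b = act b'" shows "act (a + b) = act (a' + b')"
  using act_cong_union_right[OF assms(1)] act_cong_union_right[OF assms(2)] by (metis add.commute)

text \<open>
  The group of all \<open>act c\<close> acts on the classes of multisets: add \<open>c\<close> on the left and cancel \<open>act c\<close> in the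
  cocycle identity.
\<close>

lemma act_cong_image:
  assumes "act a = act b"
  shows "act (image_mset (act c) a) = act (image_mset (act c) b)"
proof -
  have "act (image_mset (act c) a) \<circ> act c = act (image_mset (act c) b) \<circ> act c"
    using act_cong_union[OF refl assms, of c] by (simp add: act_union)
  then show ?thesis using permutes_inv_o(1)[OF act_permutes, of c] by (metis comp_assoc comp_id)
qed

lemma act_image_eq_id:
  assumes "act a = id" shows "act (image_mset (act c) a) = id"
  using act_cong_image[of a "{#}" c] assms by simp

text \<open>
  The second group structure on the permutation group: the quotient of the free commutative monoid of
  multisets by the congruence \<open>act a = act b\<close>, transported to the permutations along \<open>act\<close>. Its neutral
  element is that of composition, and the two operations together form a brace.
\<close>

definition add_group :: "('a \<Rightarrow> 'a) monoid" where
  "add_group = \<lparr>carrier = range act,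
     mult = (\<lambda>u v. act (inv_into UNIV act u + inv_into UNIV act v)), one = id\<rparr>"

lemma carrier_add_group [simp]: "carrier add_group = range act"
  and one_add_group [simp]: "\<one>\<^bsub>add_group\<^esub> = id"
  by (simp_all add: add_group_def)

lemma mult_add_group [simp]: "act a \<otimes>\<^bsub>add_group\<^esub> act b = act (a + b)"
  unfolding add_group_def monoid.simps by (intro act_cong_union f_inv_into_f rangeI)

text \<open>
  Only inverses need an argument. If \<open>d\<close> represents the inverse permutation of \<open>act a\<close>, then the
  image of \<open>d\<close> under that inverse is a negative of \<open>a\<close>, by the cocycle identity.
\<close>

lemma comm_group_add_group: "comm_group add_group"
proof (rule comm_groupI)
  show "\<one>\<^bsub>add_group\<^esub> \<in> carrier add_group" by (simp add: image_iff) (metis act_empty)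
  show "\<one>\<^bsub>add_group\<^esub> \<otimes>\<^bsub>add_group\<^esub> u = u" if "u \<in> carrier add_group" for u
    using that mult_add_group[of "{#}"] by auto
  show "\<exists>v\<in>carrier add_group. v \<otimes>\<^bsub>add_group\<^esub> u = \<one>\<^bsub>add_group\<^esub>"
    if u: "u \<in> carrier add_group" for u
  proof -
    obtain a where a: "u = act a" using u by auto
    obtain d where d: "Hilbert_Choice.inv (act a) = act d" using act_inverse .
    let ?b = "image_mset (Hilbert_Choice.inv (act a)) d"
    have "act (a + ?b) = act d \<circ> act a" by (simp add: comp_act)
    then have "act (?b + a) = id" using d permutes_inv_o(2)[OF act_permutes, of a]
      by (simp add: add.commute)
    then show ?thesis using a by force
  qed
qed (auto simp: ac_simps)

sublocale add: comm_group add_group by (rule comm_group_add_group)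

lemma pow_add_group: "act a [^]\<^bsub>add_group\<^esub> (n::nat) = act (repeat_mset n a)"
  by (induction n) (auto simp: ac_simps)

lemma image_mset_repeat: "image_mset f (repeat_mset n a) = repeat_mset n (image_mset f a)"
  by (induction n) auto

lemma torsion_act_iff: "act a \<in> torsion add_group n \<longleftrightarrow> act (repeat_mset n a) = id"
  by (simp add: torsion_def pow_add_group)

lemma torsion_image: "act a \<in> torsion add_group n \<Longrightarrow> act (image_mset (act c) a) \<in> torsion add_group n"
  using act_image_eq_id by (simp add: torsion_act_iff image_mset_repeat[symmetric])

lemma finite_add_group: "finite (carrier add_group)"
  using perm_group_finite[OF finite_X perm_group_act] by simp

text \<open>
  A torsion subgroup of the additive group is stable under the action of the permutations. As a
  composition is a sum with one summand moved by such a permutation, it is closed under composition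
  too.
\<close>

lemma perm_group_torsion: "perm_group X (torsion add_group n)"
  unfolding perm_group_def
proof (intro conjI ballI)
  have T: "torsion add_group n \<subseteq> range act" by (auto simp: torsion_def)
  show "u permutes X" if "u \<in> torsion add_group n" for u using that T act_permutes by auto
  show "id \<in> torsion add_group n" using torsion_act_iff[of "{#}"] by simp
  fix u v assume uv: "u \<in> torsion add_group n" "v \<in> torsion add_group n"
  then obtain c a where ca: "u = act c" "v = act a" using T by blast
  obtain d where d: "Hilbert_Choice.inv (act a) = act d" using act_inverse .
  have "u \<circ> v = act a \<otimes>\<^bsub>add_group\<^esub> act (image_mset (act d) c)" using ca by (simp add: comp_act d)
  then show "u \<circ> v \<in> torsion add_group n"
    using uv ca torsion_image add.subgroup_torsion subgroup.m_closed by metis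
qed

end

section \<open>Transitive cycle sets of prime size\<close>

locale transitive_prime_cycle_set = finite_cycle_set +
  fixes p :: nat
  assumes prime: "prime p" and card_X: "card X = p"
    and transitive: "\<And>x y. x \<in> X \<Longrightarrow> y \<in> X \<Longrightarrow> \<exists>a. act a x = y"
begin

abbreviation P where "P \<equiv> torsion add_group p"

definition m :: nat where "m = order add_group div p"

lemma act_in_X: "act a x \<in> X \<longleftrightarrow> x \<in> X"
  using permutes_in_image[OF act_permutes] .

lemma X_nonempty: "X \<noteq> {}"
  using card_X prime by (auto simp: not_prime_0)

text \<open>
  Transitivity on \<open>p\<close> points makes \<open>p\<close> a divisor of the order; as the order divides \<open>p!\<close>, the square
  of \<open>p\<close> is not one.
\<close>

lemma order_add_group: "order add_group = p * m"
  and not_square_dvd: "\<not> p\<^sup>2 dvd order add_group"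
proof -
  obtain x where x: "x \<in> X" using X_nonempty by auto
  have "(\<lambda>h. h x) ` range act = X"
    using transitive[OF x] act_in_X x by (auto simp: image_iff) metis
  then have "p dvd order add_group"
    using card_orbit_dvd[OF finite_X perm_group_act, of x] card_X by (simp add: order_def)
  then show "order add_group = p * m" by (simp add: m_def)
  have "order add_group dvd fact p"
    using card_perm_group_dvd_fact[OF finite_X perm_group_act] card_X by (simp add: order_def)
  then show "\<not> p\<^sup>2 dvd order add_group"
    using not_prime_square_dvd_fact[OF prime] dvd_trans by blast
qed

lemma not_dvd_m: "\<not> p dvd m"
  using not_square_dvd by (auto simp: order_add_group power2_eq_square)

lemma card_P: "card P = p"
  using add.card_torsion_prime[OF finite_add_group prime _ not_square_dvd] order_add_group by simp

text \<open>
  Orbits of \<open>P\<close> have size dividing \<open>card P = p\<close>, and a point moved by some element of \<open>P\<close> has an orbit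
  with more than one element, hence with all \<open>p\<close> of them.
\<close>

lemma P_transitive:
  assumes x: "x \<in> X" and y: "y \<in> X"
  obtains h where "h \<in> P" "h x = y"
proof -
  note pg = perm_group_torsion[of p]
  have "\<not> P \<subseteq> {id}"
    using card_mono[of "{id}" P] card_P prime_gt_1_nat[OF prime] by auto
  then obtain h where h: "h \<in> P" "h \<noteq> id" by auto
  then obtain z where z: "h z \<noteq> z" by (auto simp: fun_eq_iff)
  let ?O = "(\<lambda>k. k z) ` P"
  have hX: "k permutes X" if "k \<in> P" for k using perm_group_permutes[OF pg that] .
  have zX: "z \<in> X" using z hX[OF h(1)] by (meson permutes_not_in)
  have OX: "?O \<subseteq> X" using permutes_in_image[OF hX] zX by auto
  have "{z, h z} \<subseteq> ?O" using h perm_group_id[OF pg] by (metis (no_types, lifting) empty_subsetI id_apply image_eqI insert_subset)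
  then have "card {z, h z} \<le> card ?O" using OX finite_X by (meson card_mono finite_subset)
  then have "card ?O \<noteq> 1" using z by simp
  moreover have "card ?O dvd p" using card_orbit_dvd[OF finite_X pg] card_P by metis
  ultimately have "card ?O = p" using prime prime_nat_iff by blast
  then have O: "?O = X" using OX finite_X card_X by (simp add: card_subset_eq)
  obtain h1 h2 where h12: "h1 \<in> P" "x = h1 z" "h2 \<in> P" "y = h2 z" using O x y by auto
  have "(h2 \<circ> Hilbert_Choice.inv h1) x = y"
    using h12 permutes_inverses(2)[OF hX[OF h12(1)]] by simp
  moreover have "h2 \<circ> Hilbert_Choice.inv h1 \<in> P"
    using perm_group_comp[OF pg h12(3) perm_group_inv[OF finite_X pg h12(1)]] .
  ultimately show ?thesis using that by blast
qed

lemma act_m_in_P: "act (repeat_mset m a) \<in> P"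
proof -
  have "act a [^]\<^bsub>add_group\<^esub> order add_group = \<one>\<^bsub>add_group\<^esub>"
    by (rule add.pow_order_eq_1) simp
  then show ?thesis by (simp add: torsion_act_iff pow_add_group order_add_group)
qed

text \<open>
  The \<open>P\<close>-orbit of an element of \<open>P\<close> has size \<open>1\<close> or \<open>p\<close>. The neutral element is fixed, so the other
  orbits lie in a set with \<open>p - 1\<close> elements and must be singletons.
\<close>

lemma P_acts_trivially:
  assumes h: "h \<in> P" and a: "act a \<in> P"
  shows "act (image_mset h a) = act a"
proof (cases "act a = id")
  case True
  obtain c where "h = act c" using h by (auto simp: torsion_def)
  then show ?thesis using act_image_eq_id True by metis
next
  case False
  note pg = perm_group_torsion[of p]
  let ?F = "\<lambda>h. act (image_mset h a)"
  have "card (?F ` P) * card {k \<in> P. ?F k = ?F id} = card P"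
  proof (rule card_image_mult_card_fibre[OF finite_X pg, where F = ?F])
    fix g h k assume g: "g \<in> P" and eq: "?F h = ?F k"
    obtain c where "g = act c" using g by (auto simp: torsion_def)
    then have "act (image_mset g (image_mset h a)) = act (image_mset g (image_mset k a))"
      using act_cong_image[OF eq] by blast
    then show "?F (g \<circ> h) = ?F (g \<circ> k)" by (simp add: multiset.map_comp)
  qed
  then have dvd: "card (?F ` P) dvd p" unfolding card_P by (rule dvdI[OF sym])
  have fin: "finite P" using perm_group_finite[OF finite_X pg] .
  have "?F ` P \<subseteq> P - {id}"
  proof (intro image_subsetI DiffI)
    fix k assume k: "k \<in> P"
    then obtain c where c: "k = act c" by (auto simp: torsion_def)
    show "?F k \<in> P" using torsion_image[OF a] c by simp
    show "?F k \<notin> {id}"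
    proof
      assume "?F k \<in> {id}"
      obtain d where d: "Hilbert_Choice.inv k = act d" using act_inverse c by blast
      have "act (image_mset (act d) (image_mset k a)) = id"
        using \<open>?F k \<in> {id}\<close> by (intro act_image_eq_id) simp
      moreover have "image_mset (act d) (image_mset k a) = a"
        using permutes_inv_o(2)[OF act_permutes[of c]] c d by (simp add: multiset.map_comp)
      ultimately show False using False by simp
    qed
  qed
  then have "card (?F ` P) \<le> card (P - {id})" by (rule card_mono[OF finite_Diff[OF fin]])
  also have "\<dots> < p" using card_Diff1_less[OF fin perm_group_id[OF pg]] unfolding card_P .
  finally have "card (?F ` P) \<noteq> p" by simp
  then have "card (?F ` P) = 1" using dvd prime prime_nat_iff by blast
  then obtain v where v: "?F ` P = {v}" by (rule card_1_singletonE)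
  have "?F h = ?F id"
    using imageI[OF h, of ?F] imageI[OF perm_group_id[OF pg], of ?F] unfolding v by simp
  then show ?thesis by simp
qed

text \<open>
  The class of \<open>m\<close> copies of a letter of \<open>X\<close>. The choice of the letter is immaterial by lemma
  \<open>act_repeat_single\<close>: such classes lie in \<open>P\<close>, which acts trivially on them and transitively on the
  letters.
\<close>

definition base_class :: "'a \<Rightarrow> 'a" where
  "base_class = act (repeat_mset m {#SOME x. x \<in> X#})"

lemma act_repeat_single:
  assumes "x \<in> X" shows "act (repeat_mset m {#x#}) = base_class"
proof -
  let ?x = "SOME x. x \<in> X"
  have "?x \<in> X" using X_nonempty by (simp add: some_in_eq)
  then obtain h where h: "h \<in> P" "h ?x = x" using P_transitive assms by blast
  have "act (image_mset h (repeat_mset m {#?x#})) = base_class"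
    unfolding base_class_def using P_acts_trivially[OF h(1) act_m_in_P] .
  then show ?thesis using h by (simp add: image_mset_repeat)
qed

text \<open>
  Letters outside \<open>X\<close> act as the identity and are therefore not counted.
\<close>

definition degree :: "'a multiset \<Rightarrow> nat" where
  "degree a = size (filter_mset (\<lambda>x. x \<in> X) a)"

lemma degree_union: "degree (a + b) = degree a + degree b"
  by (simp add: degree_def)

lemma degree_image: "degree (image_mset (act c) a) = degree a"
  by (induction a) (auto simp: degree_def act_in_X)

lemma act_repeat: "act (repeat_mset m a) = base_class [^]\<^bsub>add_group\<^esub> degree a"
proof (induction a)
  case (add x a)
  have U: "base_class \<in> carrier add_group" by (simp add: base_class_def)
  have single: "act (repeat_mset m {#x#}) = base_class [^]\<^bsub>add_group\<^esub> degree {#x#}"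
  proof (cases "x \<in> X")
    case True
    then show ?thesis using act_repeat_single[OF True] add.nat_pow_eone[OF U]
      by (simp add: degree_def)
  next
    case False
    then have "act {#x#} = id" using outside by (simp add: act_single)
    then have "act {#x#} [^]\<^bsub>add_group\<^esub> m = id" using add.nat_pow_one by simp
    then show ?thesis using False by (simp add: degree_def pow_add_group)
  qed
  have "act (repeat_mset m (add_mset x a)) = act {#x#} [^]\<^bsub>add_group\<^esub> m \<otimes>\<^bsub>add_group\<^esub> act a [^]\<^bsub>add_group\<^esub> m"
    by (simp add: pow_add_group repeat_mset_distrib_add_mset add.commute)
  also have "\<dots> = base_class [^]\<^bsub>add_group\<^esub> (degree {#x#} + degree a)"
    using single add.IH U by (simp add: pow_add_group add.nat_pow_mult)
  finally show ?case by (simp add: degree_union[symmetric])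
qed (simp add: degree_def)

text \<open>
  If it were neutral, the whole additive group would be killed by \<open>m\<close>, which is prime to \<open>p\<close>, although by
  Cauchy's theorem the group contains an element of order \<open>p\<close>.
\<close>

lemma base_class: "base_class \<noteq> id" "base_class \<in> P"
proof -
  show P: "base_class \<in> P" unfolding base_class_def by (rule act_m_in_P)
  show "base_class \<noteq> id"
  proof
    assume "base_class = id"
    have all: "u [^]\<^bsub>add_group\<^esub> m = id" if u: "u \<in> carrier add_group" for u
      using u act_repeat \<open>base_class = id\<close> add.nat_pow_one by (auto simp: pow_add_group)
    obtain u where u: "u \<in> carrier add_group" "u \<noteq> id" "u [^]\<^bsub>add_group\<^esub> p = id"
      using add.cauchy[OF finite_add_group prime] order_add_group by auto
    show False using add.pow_eq_one_imp_dvd[OF prime u(1)] u all not_dvd_m by simp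
  qed
qed

text \<open>
  Since \<open>m\<close> copies of \<open>a\<close> give the \<open>degree a\<close>-fold multiple of an element of order \<open>p\<close>, the degree
  modulo \<open>p\<close> depends only on \<open>act a\<close>, and the \<open>m\<close>-torsion is where it vanishes.
\<close>

lemma act_in_torsion_iff: "act a \<in> torsion add_group m \<longleftrightarrow> p dvd degree a"
proof -
  have U: "base_class \<in> carrier add_group" "base_class [^]\<^bsub>add_group\<^esub> p = id"
    using base_class by (auto simp: torsion_def)
  have "base_class [^]\<^bsub>add_group\<^esub> degree a = id" if "p dvd degree a"
  proof -
    obtain k where "degree a = p * k" using \<open>p dvd degree a\<close> ..
    then have "base_class [^]\<^bsub>add_group\<^esub> degree a = (base_class [^]\<^bsub>add_group\<^esub> p) [^]\<^bsub>add_group\<^esub> k"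
      using U(1) by (simp only: add.nat_pow_pow)
    then show ?thesis using U add.nat_pow_one by simp
  qed
  then show ?thesis
    using add.pow_eq_one_imp_dvd[OF prime U(1)] U(2) base_class
    by (auto simp: torsion_act_iff act_repeat)
qed

abbreviation N where "N \<equiv> torsion add_group m"

text \<open>
  The degree is additive not only for sums but also for compositions, because the permutations preserve
  the degree of a multiset. So \<open>N\<close> is the kernel of a homomorphism from the permutation group to the
  integers modulo \<open>p\<close>.
\<close>

lemma N_normal:
  assumes "n \<in> N"
  shows "act c \<circ> n \<circ> Hilbert_Choice.inv (act c) \<in> N"
proof -
  obtain a where a: "n = act a" using assms by (auto simp: torsion_def)
  obtain d where d: "Hilbert_Choice.inv (act c) = act d" using act_inverse .
  have comp: "\<exists>e. act u \<circ> act v = act e \<and> degree e = degree u + degree v" for u v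
  proof -
    obtain w where "Hilbert_Choice.inv (act v) = act w" using act_inverse .
    then show ?thesis using comp_act[of u v] degree_image degree_union by (metis add.commute)
  qed
  obtain e where e: "act c \<circ> act d = act e" "degree e = degree c + degree d" using comp by blast
  have "act e = act {#}" using e d permutes_inv_o(1)[OF act_permutes, of c] by simp
  then have "p dvd degree e" using act_in_torsion_iff[of e] act_in_torsion_iff[of "{#}"]
    by (simp add: degree_def)
  obtain e1 where e1: "act c \<circ> n = act e1" "degree e1 = degree c + degree a" using comp a by blast
  obtain e2 where e2: "act e1 \<circ> act d = act e2" "degree e2 = degree e1 + degree d" using comp by blast
  have "degree e2 = degree e + degree a" using e e1 e2 by simp
  moreover have "p dvd degree a" using assms a act_in_torsion_iff by simp
  ultimately have "p dvd degree e2" using \<open>p dvd degree e\<close> by simp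
  then show ?thesis using e1 e2 d act_in_torsion_iff by simp
qed

text \<open>
  By normality, permutations carry \<open>N\<close>-orbits to \<open>N\<close>-orbits. As \<open>P\<close> is transitive of order \<open>p\<close>, the number
  of \<open>N\<close>-orbits divides \<open>p\<close>. A single orbit would make \<open>p\<close> divide \<open>card N\<close>, which is prime to \<open>p\<close>; so
  there are \<open>p\<close> orbits, all of them singletons.
\<close>

lemma N_trivial: "N = {id}"
proof -
  note pg = perm_group_torsion[of m] and pgP = perm_group_torsion[of p]
  let ?orb = "\<lambda>x. (\<lambda>n. n x) ` N"
  have not_dvd: "\<not> p dvd card N"
    using add.prime_dvd_card_torsion[OF finite_add_group prime] not_dvd_m by blast
  have orb_act: "?orb (act c x) = act c ` ?orb x" for c x
  proof (intro equalityI subsetI)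
    fix y assume "y \<in> ?orb (act c x)"
    then obtain n where n: "n \<in> N" "y = n (act c x)" by auto
    obtain d where d: "Hilbert_Choice.inv (act c) = act d" using act_inverse .
    have "act d \<circ> n \<circ> Hilbert_Choice.inv (act d) \<in> N" using N_normal n by blast
    moreover have "Hilbert_Choice.inv (act d) = act c"
      using d inv_inv_eq[OF permutes_bij[OF act_permutes]] by metis
    moreover have "y = act c ((act d \<circ> n \<circ> act c) x)"
      using n d permutes_inverses(1)[OF act_permutes, of c] by (metis comp_apply)
    ultimately show "y \<in> act c ` ?orb x" by (metis (no_types, lifting) image_eqI)
  next
    fix y assume "y \<in> act c ` ?orb x"
    then obtain n where n: "n \<in> N" "y = act c (n x)" by auto
    have "y = (act c \<circ> n \<circ> Hilbert_Choice.inv (act c)) (act c x)"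
      using n permutes_inverses(2)[OF act_permutes, of c] by simp
    then show "y \<in> ?orb (act c x)" using N_normal[OF n(1)] by blast
  qed
  obtain x where x: "x \<in> X" using X_nonempty by auto
  have PX: "(\<lambda>h. h x) ` P = X"
  proof (intro equalityI subsetI)
    fix y assume "y \<in> (\<lambda>h. h x) ` P"
    then show "y \<in> X" using permutes_in_image[OF perm_group_permutes[OF pgP]] x by blast
  next
    fix y assume "y \<in> X"
    then show "y \<in> (\<lambda>h. h x) ` P" using P_transitive[OF x] by blast
  qed
  have "card ((\<lambda>h. ?orb (h x)) ` P) * card {k \<in> P. ?orb (k x) = ?orb (id x)} = card P"
  proof (rule card_image_mult_card_fibre[OF finite_X pgP, where F = "\<lambda>h. ?orb (h x)"])
    fix g h k assume g: "g \<in> P" and eq: "?orb (h x) = ?orb (k x)"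
    obtain c where c: "g = act c" using g by (auto simp: torsion_def)
    show "?orb ((g \<circ> h) x) = ?orb ((g \<circ> k) x)" unfolding comp_apply c orb_act eq ..
  qed
  then have "card ((\<lambda>h. ?orb (h x)) ` P) dvd p" unfolding card_P by (rule dvdI[OF sym])
  moreover have "(\<lambda>h. ?orb (h x)) ` P = ?orb ` X" by (subst PX[symmetric]) (simp only: image_image)
  ultimately have "card (?orb ` X) dvd p" by simp
  then consider "card (?orb ` X) = 1" | "card (?orb ` X) = p" using prime prime_nat_iff by blast
  then show ?thesis
  proof cases
    case 1
    then obtain Y where Y: "?orb ` X = {Y}" by (rule card_1_singletonE)
    have self: "y \<in> ?orb y" for y
      by (rule image_eqI[where x = id]) (simp_all add: perm_group_id[OF pg])
    have "?orb y = ?orb x" if "y \<in> X" for y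
      using Y imageI[OF that, of ?orb] imageI[OF x, of ?orb] by simp
    then have "X \<subseteq> ?orb x" using self by blast
    moreover have "?orb x \<subseteq> X" using permutes_in_image[OF perm_group_permutes[OF pg]] x by blast
    ultimately have "?orb x = X" by (rule subset_antisym[rotated])
    then have "card (?orb x) = p" using card_X by simp
    then show ?thesis using card_orbit_dvd[OF finite_X pg, of x] not_dvd by simp
  next
    case 2
    then have inj: "inj_on ?orb X" using finite_X card_X by (intro eq_card_imp_inj_on) auto
    have "n = id" if n: "n \<in> N" for n
    proof
      fix y show "n y = id y"
      proof (cases "y \<in> X")
        case False
        then show ?thesis using permutes_not_in[OF perm_group_permutes[OF pg n]] by simp
      next
        case True
        have nX: "n permutes X" using perm_group_permutes[OF pg n] .
        have "?orb (n y) = ?orb y"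
        proof (intro equalityI subsetI)
          fix z assume "z \<in> ?orb (n y)"
          then obtain k where "k \<in> N" "z = (k \<circ> n) y" by auto
          then show "z \<in> ?orb y" using perm_group_comp[OF pg _ n] by blast
        next
          fix z assume "z \<in> ?orb y"
          then obtain k where k: "k \<in> N" "z = k y" by auto
          then have "z = (k \<circ> Hilbert_Choice.inv n) (n y)"
            using permutes_inverses(2)[OF nX] by simp
          then show "z \<in> ?orb (n y)"
            using perm_group_comp[OF pg k(1) perm_group_inv[OF finite_X pg n]] by blast
        qed
        then have "n y = y" using inj True permutes_in_image[OF nX] by (meson inj_onD)
        then show ?thesis by simp
      qed
    qed
    then show ?thesis using perm_group_id[OF pg] by blast
  qed
qed

text \<open>
  All letters of \<open>X\<close> have degree one, so the additive difference of two of them lies in the trivial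
  group \<open>N\<close>.
\<close>

lemma sigma_constant:
  assumes x: "x \<in> X" and y: "y \<in> X"
  shows "\<sigma> x = \<sigma> y"
proof -
  obtain d where d: "Hilbert_Choice.inv (act {#y#}) = act d" using act_inverse .
  have d': "act d \<circ> act {#y#} = id" using d permutes_inv_o(2)[OF act_permutes, of "{#y#}"] by simp
  \<comment> \<open>The second summand is a negative of \<open>y\<close>, as \<open>act d\<close> is the inverse of \<open>act {#y#}\<close>.\<close>
  let ?e = "\<lambda>x. {#x#} + image_mset (act d) d"
  have deg: "degree (?e x) = degree (?e y)" using x y by (simp add: degree_def)
  have "act (?e y) = act d \<circ> act {#y#}" using comp_act[of d "{#y#}"] d by simp
  then have "act (?e y) = id" using d' by simp
  then have "act (?e y) \<in> N" using N_trivial by simp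
  then have "act (?e x) \<in> N" using deg act_in_torsion_iff by simp
  then have "act (?e x) = act (?e y)" using N_trivial \<open>act (?e y) = id\<close> by simp
  then have "act {#x#} = act {#y#}"
    using add.right_cancel[of "act (image_mset (act d) d)" "act {#x#}" "act {#y#}"] mult_add_group
    by (metis carrier_add_group rangeI)
  then show ?thesis by (simp add: act_single)
qed

end

section \<open>From symmetric sets to cycle sets\<close>

locale finite_nondegenerate_symmetric_set =
  fixes X :: "'a set" and S :: "'a \<times> 'a \<Rightarrow> 'a \<times> 'a"
  assumes finite_carrier: "finite X" and symmetric_set: "nondegenerate_symmetric_set X S"
begin

lemma bij_f: "y \<in> X \<Longrightarrow> bij_betw (f_map S y) X X"
  and bij_g: "x \<in> X \<Longrightarrow> bij_betw (g_map S x) X X"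
  and bij_S: "bij_betw S (X \<times> X) (X \<times> X)"
  using symmetric_set
  by (auto simp: nondegenerate_symmetric_set_def nondegenerate_def bijective_pair_def)

lemma S_eq: "S (x, y) = (g_map S x y, f_map S y x)"
  by (simp add: g_map_def f_map_def)

lemma f_in: "x \<in> X \<Longrightarrow> y \<in> X \<Longrightarrow> f_map S y x \<in> X"
  and g_in: "x \<in> X \<Longrightarrow> y \<in> X \<Longrightarrow> g_map S x y \<in> X"
  using bij_f bij_g bij_betwE by blast+

lemma involution:
  assumes "x \<in> X" "y \<in> X"
  shows "f_map S (f_map S y x) (g_map S x y) = y"
proof -
  have "S (S (x, y)) = (x, y)"
    using symmetric_set assms by (auto simp: nondegenerate_symmetric_set_def involutive_def)
  then show ?thesis by (simp add: S_eq)
qed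

lemma braid:
  assumes "x \<in> X" "y \<in> X" "z \<in> X"
  shows "f_map S z (f_map S y x) = f_map S (f_map S z y) (f_map S (g_map S y z) x)"
proof -
  have "(S12 S \<circ> S23 S \<circ> S12 S) (x, y, z) = (S23 S \<circ> S12 S \<circ> S23 S) (x, y, z)"
    using symmetric_set assms by (auto simp: nondegenerate_symmetric_set_def braided_def)
  then show ?thesis by (simp add: S12_def S23_def S_eq)
qed

text \<open>
  The maps of a cycle set are permutations of the whole type, hence the extension by the identity.
\<close>

definition \<tau> :: "'a \<Rightarrow> 'a \<Rightarrow> 'a" where
  "\<tau> y = (\<lambda>x. if y \<in> X \<and> x \<in> X then f_map S y x else x)"

definition \<sigma> :: "'a \<Rightarrow> 'a \<Rightarrow> 'a" where
  "\<sigma> y = Hilbert_Choice.inv (\<tau> y)"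

lemma tau_eq: "y \<in> X \<Longrightarrow> x \<in> X \<Longrightarrow> \<tau> y x = f_map S y x"
  by (simp add: \<tau>_def)

lemma tau_permutes: "\<tau> y permutes X"
proof (cases "y \<in> X")
  case True
  have "bij_betw (\<tau> y) X X \<longleftrightarrow> bij_betw (f_map S y) X X"
    using True by (intro bij_betw_cong) (simp add: tau_eq)
  then show ?thesis using bij_f[OF True] by (intro bij_imp_permutes) (auto simp: \<tau>_def)
next
  case False
  then have "\<tau> y = id" by (auto simp: \<tau>_def)
  then show ?thesis using permutes_id by metis
qed

lemma sigma_permutes: "\<sigma> y permutes X"
  unfolding \<sigma>_def using tau_permutes by (rule permutes_inv)

lemma sigma_tau: "\<sigma> y (\<tau> y x) = x" and tau_sigma: "\<tau> y (\<sigma> y x) = x"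
  unfolding \<sigma>_def using permutes_inverses[OF tau_permutes] by auto

lemma sigma_in: "\<sigma> y x \<in> X \<longleftrightarrow> x \<in> X"
  using permutes_in_image[OF sigma_permutes] .

text \<open>
  Involutivity determines one family of maps by the other.
\<close>

lemma g_eq_sigma:
  assumes "x \<in> X" "y \<in> X"
  shows "g_map S x y = \<sigma> (f_map S y x) y"
  using involution[OF assms] sigma_tau[of "f_map S y x" "g_map S x y"]
    tau_eq[OF f_in[OF assms] g_in[OF assms]] by simp

lemma sigma_outside: "x \<notin> X \<Longrightarrow> \<sigma> x = id"
proof -
  assume "x \<notin> X"
  then have "\<tau> x = id" by (auto simp: \<tau>_def)
  then show ?thesis by (simp add: \<sigma>_def)
qed

lemma sigma_fixes_outside: "x \<notin> X \<Longrightarrow> \<sigma> y x = x"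
  using permutes_not_in[OF sigma_permutes] .

text \<open>
  This is the third component of the braid relation for \<open>(u, \<sigma> x y, x)\<close>; involutivity turns the index
  \<open>g_map S (\<sigma> x y) x\<close> that occurs there into \<open>\<sigma> y x\<close>. Taking inverses yields the cycle identity for \<open>\<sigma>\<close>.
\<close>

lemma tau_cycle:
  assumes x: "x \<in> X" and y: "y \<in> X"
  shows "\<tau> x \<circ> \<tau> (\<sigma> x y) = \<tau> y \<circ> \<tau> (\<sigma> y x)"
proof
  fix u
  let ?y = "\<sigma> x y"
  have y': "?y \<in> X" and x': "\<sigma> y x \<in> X" using x y sigma_in by auto
  have fy: "f_map S x ?y = y" using tau_sigma[of x y] tau_eq[OF x y'] by simp
  then have g: "g_map S ?y x = \<sigma> y x" using g_eq_sigma[OF y' x] by simp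
  show "(\<tau> x \<circ> \<tau> ?y) u = (\<tau> y \<circ> \<tau> (\<sigma> y x)) u"
  proof (cases "u \<in> X")
    case True
    then show ?thesis using braid[OF True y' x] fy g x y y' x' f_in by (simp add: tau_eq)
  next
    case False
    then show ?thesis by (simp add: \<tau>_def)
  qed
qed

lemma sigma_cycle: "\<sigma> (\<sigma> x y) \<circ> \<sigma> x = \<sigma> (\<sigma> y x) \<circ> \<sigma> y"
proof -
  consider "x \<in> X" "y \<in> X" | "x \<notin> X" | "y \<notin> X" by blast
  then show ?thesis
  proof cases
    case 1
    note b = permutes_bij[OF tau_permutes]
    show ?thesis
      using tau_cycle[OF 1] o_inv_distrib[OF b b, of x "\<sigma> x y"] o_inv_distrib[OF b b, of y "\<sigma> y x"]
      unfolding \<sigma>_def by simp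
  qed (simp_all add: sigma_outside sigma_fixes_outside)
qed

sublocale finite_cycle_set X \<sigma>
  by unfold_locales (rule finite_carrier sigma_permutes sigma_outside sigma_cycle | assumption)+

text \<open>
  On a finite subset stable under all \<open>\<sigma> u\<close>, these injective maps are bijective, so their inverses
  preserve the subset, and with them both families of component maps of \<open>S\<close>.
\<close>

lemma closed_subset_nondegenerate:
  assumes W: "W \<subseteq> X" "W \<noteq> {}" and closed: "\<And>u w. u \<in> X \<Longrightarrow> w \<in> W \<Longrightarrow> \<sigma> u w \<in> W"
  shows "nondegenerate_invariant_subset X S W"
proof -
  have fin: "finite W" using W finite_carrier finite_subset by blast
  have sigma_W: "\<sigma> u ` W = W" if "u \<in> X" for u
    using closed[OF that] permutes_inj_on[OF sigma_permutes] by (intro endo_inj_surj fin) auto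
  have f_W: "f_map S y x \<in> W" if y: "y \<in> X" and x: "x \<in> W" for x y
  proof -
    obtain w where w: "w \<in> W" "x = \<sigma> y w" using sigma_W[OF y] x by blast
    have "f_map S y x = \<tau> y x" using tau_eq[OF y] x W by auto
    also have "\<dots> = w" using w tau_sigma by simp
    finally show ?thesis using w by simp
  qed
  have g_W: "g_map S x y \<in> W" if "x \<in> W" "y \<in> W" for x y
    using that W closed f_in g_eq_sigma by (metis subsetD)
  have into: "S ` (W \<times> W) \<subseteq> W \<times> W" using f_W g_W W by (auto simp: S_eq)
  have sub: "W \<times> W \<subseteq> X \<times> X" using W by blast
  have bij: "bij_betw h W W" if "bij_betw h X X" "h ` W \<subseteq> W" for h :: "'a \<Rightarrow> 'a"
    using that endo_inj_surj[OF fin] inj_on_subset[OF _ W(1)] by (auto simp: bij_betw_def)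
  have bijS: "bij_betw S (W \<times> W) (W \<times> W)"
    using into endo_inj_surj[of "W \<times> W" S] fin bij_S inj_on_subset[OF _ sub]
    by (auto simp: bij_betw_def)
  have f_bij: "bij_betw (f_map S y) W W" if "y \<in> W" for y
    using bij[OF bij_f] f_W that W by (auto simp: subset_iff)
  have g_bij: "bij_betw (g_map S x) W W" if "x \<in> W" for x
    using bij[OF bij_g] g_W that W by (auto simp: subset_iff)
  have "braided W S" "involutive W S"
    using symmetric_set W unfolding nondegenerate_symmetric_set_def braided_def involutive_def
    by blast+
  then show ?thesis
    using into bijS f_bij g_bij W
    by (auto simp: nondegenerate_invariant_subset_def invariant_subset_def nondegenerate_def
        nondegenerate_symmetric_set_def bijective_pair_def)
qed

text \<open>
  An orbit of the permutation group and its complement are both stable under all \<open>\<sigma> u\<close>; if neither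
  were empty, they would decompose \<open>X\<close>.
\<close>

lemma indecomposable_imp_transitive:
  assumes indec: "\<not> decomposable X S" and x: "x \<in> X" and y: "y \<in> X"
  shows "\<exists>a. act a x = y"
proof (rule ccontr)
  assume no: "\<nexists>a. act a x = y"
  let ?Y = "(\<lambda>h. h x) ` range act"
  have sigma_act: "\<sigma> u \<circ> h \<in> range act" if "h \<in> range act" for u h
    using perm_group_comp[OF perm_group_act _ that, of "\<sigma> u"] act_single by (metis rangeI)
  have inv_act: "Hilbert_Choice.inv (\<sigma> u) \<circ> h \<in> range act" if "h \<in> range act" for u h
    using perm_group_comp[OF perm_group_act perm_group_inv[OF finite_X perm_group_act] that]
      act_single by (metis rangeI)
  have xY: "x \<in> ?Y"
    by (rule image_eqI[where x = id]) (simp_all add: perm_group_id[OF perm_group_act])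
  have YX: "?Y \<subseteq> X" using permutes_in_image[OF act_permutes] x by auto
  have yZ: "y \<in> X - ?Y" using y no by auto
  have Y_closed: "\<sigma> u w \<in> ?Y" if "w \<in> ?Y" for u w
  proof -
    from that obtain h where h: "w = h x" "h \<in> range act" by (rule imageE)
    then have "\<sigma> u w = (\<sigma> u \<circ> h) x" by (simp only: comp_apply)
    then show ?thesis using sigma_act[OF h(2)] by (rule image_eqI)
  qed
  have Z_closed: "\<sigma> u w \<in> X - ?Y" if w: "w \<in> X - ?Y" for u w
  proof -
    have "w \<in> ?Y" if "\<sigma> u w \<in> ?Y"
    proof -
      from that obtain h where h: "\<sigma> u w = h x" "h \<in> range act" by (rule imageE)
      then have "w = (Hilbert_Choice.inv (\<sigma> u) \<circ> h) x"
        using permutes_inverses(2)[OF sigma_permutes, of u w] by simp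
      then show ?thesis using inv_act[OF h(2)] by (rule image_eqI)
    qed
    then show ?thesis using w sigma_in by blast
  qed
  have "nondegenerate_invariant_subset X S ?Y"
    using YX xY Y_closed by (intro closed_subset_nondegenerate) blast+
  moreover have "nondegenerate_invariant_subset X S (X - ?Y)"
    using yZ Z_closed by (intro closed_subset_nondegenerate) blast+
  moreover have "?Y \<noteq> {}" "X - ?Y \<noteq> {}" using xY yZ by blast+
  moreover have "?Y \<inter> (X - ?Y) = {}" "?Y \<union> (X - ?Y) = X" using YX by blast+
  ultimately have "decomposable X S"
    unfolding decomposable_def by (intro exI conjI)
  then show False using indec by simp
qed

end

section \<open>Solutions given by a single cycle\<close>

lemma cyclic_S0_eq:
  assumes "n > 1"
  shows "cyclic_S0 n (x, y) = ((y - 1) mod int n, (x + 1) mod int n)"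
proof -
  interpret residues "int n" "residue_ring (int n)"
    using assms by unfold_locales auto
  show ?thesis
    by (simp add: cyclic_S0_def a_minus_def res_add_eq res_neg_eq res_one_eq mod_add_right_eq)
qed

text \<open>
  The isomorphism sends a point of the cycle to the exponent of \<open>t\<close> that reaches it from \<open>x0\<close>, so that
  \<open>t\<close> turns into adding one and the predecessor \<open>z\<close> of \<open>y\<close> into subtracting one.
\<close>

lemma permutation_solution_isomorphic_cyclic:
  assumes n: "n > 1" and bij: "bij_betw (\<lambda>k. (t ^^ k) x0) {0..<n} X" and period: "(t ^^ n) x0 = x0"
    and S: "\<And>x y. x \<in> X \<Longrightarrow> y \<in> X \<Longrightarrow> \<exists>z\<in>X. t z = y \<and> S (x, y) = (z, t x)"
  shows "isomorphic_pairs X S (carrier (residue_ring (int n))) (cyclic_S0 n)"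
proof -
  let ?e = "\<lambda>k. (t ^^ k) x0"
  define \<phi> where "\<phi> x = int (the_inv_into {0..<n} ?e x)" for x
  have phi: "\<phi> (?e k) = int (k mod n)" for k
  proof -
    have "?e k = ?e (k mod n)" using period n by (simp add: funpow_mod_eq)
    then show ?thesis
      unfolding \<phi>_def using the_inv_into_f_f[OF bij_betw_imp_inj_on[OF bij], of "k mod n"] n by simp
  qed
  have X: "\<exists>k<n. x = ?e k" if "x \<in> X" for x
    using that bij_betw_imp_surj_on[OF bij] by auto
  have step: "\<phi> (t x) = (\<phi> x + 1) mod int n" if x: "x \<in> X" for x
  proof -
    obtain k where k: "k < n" "x = ?e k" using X x by blast
    then have "\<phi> (t x) = int (Suc k mod n)" using phi[of "Suc k"] by simp
    then show ?thesis using phi[of k] k by (simp add: zmod_int add.commute)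
  qed
  have range: "0 \<le> \<phi> x \<and> \<phi> x < int n" if "x \<in> X" for x
    using X[OF that] phi n by auto
  have "bij_betw (the_inv_into {0..<n} ?e) X {0..<n}" using bij by (rule bij_betw_the_inv_into)
  moreover have "bij_betw int {0..<n} {0..int n - 1}"
    by (rule bij_betw_byWitness[where f' = nat]) auto
  ultimately have "bij_betw (int \<circ> the_inv_into {0..<n} ?e) X {0..int n - 1}"
    by (rule bij_betw_trans)
  then have "bij_betw \<phi> X {0..int n - 1}" unfolding \<phi>_def comp_def .
  moreover have "carrier (residue_ring (int n)) = {0..int n - 1}"
    by (simp add: residue_ring_def)
  moreover have "map_prod \<phi> \<phi> (S (x, y)) = cyclic_S0 n (\<phi> x, \<phi> y)" if xy: "x \<in> X" "y \<in> X" for x y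
  proof -
    obtain z where z: "z \<in> X" "t z = y" "S (x, y) = (z, t x)" using S xy by blast
    have "(\<phi> y - 1) mod int n = \<phi> z mod int n"
      using step[OF z(1)] z(2) by (metis add_diff_cancel_right' mod_diff_left_eq)
    then have "\<phi> z = (\<phi> y - 1) mod int n" using range[OF z(1)] by simp
    then show ?thesis using z step[OF xy(1)] cyclic_S0_eq[OF n] by simp
  qed
  ultimately show ?thesis unfolding isomorphic_pairs_def by (intro exI[of _ \<phi>]) auto
qed

theorem theorem2p12:
  fixes X :: "'a set" and S :: "'a \<times> 'a \<Rightarrow> 'a \<times> 'a" and p :: nat
  assumes "nondegenerate_symmetric_set X S"
    and "\<not> decomposable X S"
    and "prime p"
    and "card X = p"
  shows "isomorphic_pairs X S (carrier (residue_ring (int p))) (cyclic_S0 p)"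
proof -
  have p: "p > 1" using assms(3) by (rule prime_gt_1_nat)
  then have fin: "finite X" using assms(4) card.infinite by fastforce
  interpret finite_nondegenerate_symmetric_set X S
    using assms(1) fin by unfold_locales
  interpret transitive_prime_cycle_set X \<sigma> p
  proof
    show "prime p" "card X = p" using assms by simp_all
    show "\<exists>a. act a x = y" if "x \<in> X" "y \<in> X" for x y
      using indecomposable_imp_transitive[OF assms(2) that] .
  qed
  obtain x0 where x0: "x0 \<in> X" using X_nonempty by auto
  define t where "t = \<tau> x0"
  have sigma: "\<sigma> x = Hilbert_Choice.inv t" if "x \<in> X" for x
    using sigma_constant[OF that x0] by (simp add: t_def \<sigma>_def)
  have tX: "t permutes X" by (simp add: t_def tau_permutes)
  have tau: "\<tau> x = t" if "x \<in> X" for x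
  proof -
    have "\<tau> x = Hilbert_Choice.inv (\<sigma> x)"
      unfolding \<sigma>_def by (rule inv_inv_eq[OF permutes_bij[OF tau_permutes], symmetric])
    also have "\<dots> = t" unfolding sigma[OF that] by (rule inv_inv_eq[OF permutes_bij[OF tX]])
    finally show ?thesis .
  qed
  \<comment> \<open>Every \<open>act a\<close> is a product of inverses of \<open>t\<close>, so that transitivity makes \<open>X\<close> one cycle of \<open>t\<close>.\<close>
  have act_pow: "\<exists>n. t ^^ n \<circ> act a = id" for a
  proof (induction a)
    case empty
    show ?case by (rule exI[of _ 0]) simp
  next
    case (add x a)
    then obtain n where n: "t ^^ n \<circ> act a = id" by blast
    show ?case
    proof (cases "act a x \<in> X")
      case True
      have "t ^^ Suc n \<circ> act (add_mset x a) = t ^^ n \<circ> (t \<circ> Hilbert_Choice.inv t) \<circ> act a"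
        unfolding act_add_mset sigma[OF True] funpow_Suc_right by (simp only: comp_assoc)
      also have "\<dots> = id" using n permutes_inv_o(1)[OF tX] by simp
      finally show ?thesis by blast
    next
      case False
      then have "act (add_mset x a) = act a" by (simp add: act_add_mset sigma_outside)
      then show ?thesis using n by metis
    qed
  qed
  have perm: "permutation t" using tX fin permutation_permutes by blast
  have "orbit t x0 = X"
  proof (intro equalityI subsetI)
    fix y assume "y \<in> orbit t x0"
    then show "y \<in> X"
      by (induction rule: orbit.induct) (use x0 permutes_in_image[OF tX] in auto)
  next
    fix y assume "y \<in> X"
    then obtain a where a: "act a y = x0" using transitive x0 by blast
    obtain n where "t ^^ n \<circ> act a = id" using act_pow by blast
    then have "(t ^^ n) x0 = y" using a by (metis comp_apply id_apply)
    then show "y \<in> orbit t x0" unfolding orbit_altdef_permutation[OF perm] by blast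
  qed
  moreover note self = permutation_self_in_orbit[OF perm, of x0]
  ultimately have bij: "bij_betw (\<lambda>k. (t ^^ k) x0) {0..<funpow_dist1 t x0 x0} X"
    using inj_on_funpow_dist1[OF self] orbit_conv_funpow_dist1[OF self] by (simp add: bij_betw_def)
  then have dist: "funpow_dist1 t x0 x0 = p" using bij_betw_same_card assms(4) by fastforce
  show ?thesis
  proof (rule permutation_solution_isomorphic_cyclic[OF p])
    show "bij_betw (\<lambda>k. (t ^^ k) x0) {0..<p} X" using bij dist by simp
    show "(t ^^ p) x0 = x0" using funpow_dist1_prop[OF self] dist by simp
    fix x y assume xy: "x \<in> X" "y \<in> X"
    have "g_map S x y = Hilbert_Choice.inv t y"
      using g_eq_sigma[OF xy] sigma f_in xy by simp
    then have "t (g_map S x y) = y" using permutes_inverses(1)[OF tX] by simp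
    moreover have "f_map S y x = t x" using tau_eq[OF xy(2) xy(1)] tau[OF xy(2)] by simp
    ultimately show "\<exists>z\<in>X. t z = y \<and> S (x, y) = (z, t x)"
      using g_in[OF xy] S_eq by (intro bexI[of _ "g_map S x y"]) auto
  qed
qed

end
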